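(* Let $n$ be a positive integer, let $Q$ be a quandle and let $x\in Q$ be such that for every element $a\in Q$ there exist an integer $i$ with $1\le i\le n$ and elements $x_1,\dots,x_i\in Q$ such that $R_{x_i}\cdots R_{x_1}(x)=a$. If $Q$ is not $m$-connected for every $m$ with $1\le m\le n-1$, then $Q$ is $n$-connected.
   Context: A quandle is a non-empty set $Q$ with a binary operation $*$ such that: (Q1) $x*x=x$ for all $x$; (Q2) for all $x,y\in Q$ there is a unique $z\in Q$ with $x=z*y$; (Q3) $(x*y)*z=(x*z)*(y*z)$ for all $x,y,z$. For $y\in Q$, $R_y:Q\to Q$ is $R_y(x)=x*y$, and $L_x:Q\to Q$ is $L_x(y)=x*y$; $R_{x_i}\cdots R_{x_1}(x)$ means $(\cdots((x*x_1)*x_2)\cdots)*x_i$. Products without parentheses are left-associated. $Q$ is $1$-connected if $L_x$ is surjective for each $x\in Q$. For $n\ge 2$, $Q$ is $n$-connected if it is not $k$-connected for any $1\le k\le n-1$ and for any $x,y\in Q$ there are $1\le l,l'\le n$ and $z_1,\dots,z_l,z'_1,\dots,z'_{l'}\in Q$ with $x=y*z_1*\cdots*z_l$ and $y=x*z'_1*\cdots*z'_{l'}$. *)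

theory Defs
  imports Main
begin

locale quandle =
  fixes Q :: "'a set" and star :: "'a \<Rightarrow> 'a \<Rightarrow> 'a"  (infixl \<open>\<star>\<close> 70)
  assumes nonempty: "Q \<noteq> {}"
    and closed: "\<lbrakk>x \<in> Q; y \<in> Q\<rbrakk> \<Longrightarrow> x \<star> y \<in> Q"
    and Q1: "x \<in> Q \<Longrightarrow> x \<star> x = x"
    and Q2: "\<lbrakk>x \<in> Q; y \<in> Q\<rbrakk> \<Longrightarrow> \<exists>!z. z \<in> Q \<and> x = z \<star> y"
    and Q3: "\<lbrakk>x \<in> Q; y \<in> Q; z \<in> Q\<rbrakk> \<Longrightarrow> (x \<star> y) \<star> z = (x \<star> z) \<star> (y \<star> z)"

definition right_transl :: "('a \<Rightarrow> 'a \<Rightarrow> 'a) \<Rightarrow> 'a \<Rightarrow> 'a \<Rightarrow> 'a" where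
  "right_transl star y = (\<lambda>x. star x y)"

definition left_transl :: "('a \<Rightarrow> 'a \<Rightarrow> 'a) \<Rightarrow> 'a \<Rightarrow> 'a \<Rightarrow> 'a" where
  "left_transl star x = (\<lambda>y. star x y)"

text \<open>The left-associated product x * z1 * ... * zl is \<open>foldl star x [z1, ..., zl]\<close>. The notion
  is meant for positive n only; the value at 0 is fixed to be false.\<close>

function connected_quandle :: "'a set \<Rightarrow> ('a \<Rightarrow> 'a \<Rightarrow> 'a) \<Rightarrow> nat \<Rightarrow> bool" where
  "connected_quandle Q star n \<longleftrightarrow>
     (if n = 0 then False
      else if n = 1 then \<forall>x\<in>Q. left_transl star x ` Q = Q
      else (\<forall>k\<in>{1..n - 1}. \<not> connected_quandle Q star k) \<and>
           (\<forall>x\<in>Q. \<forall>y\<in>Q.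
              \<exists>zs zs'. set zs \<subseteq> Q \<and> length zs \<in> {1..n} \<and>
                       set zs' \<subseteq> Q \<and> length zs' \<in> {1..n} \<and>
                       x = foldl star y zs \<and> y = foldl star x zs'))"
  by pat_completeness auto
termination
  by (relation "Wellfounded.measure (\<lambda>(Q, star, n). n)") auto

declare connected_quandle.simps [simp del]

end

theory Submission
  imports Defs
begin

text \<open>
  Right translations of a quandle are automorphisms: they preserve the operation by
  self-distributivity and are bijective by right divisibility. An automorphism carries a
  path \<open>x * z\<^sub>1 * \<dots> * z\<^sub>i = a\<close> to a path of the same length between the images of \<open>x\<close> and
  \<open>a\<close>. So if every element can be reached from \<open>x\<close> in at most \<open>n\<close> steps, the same holds
  from every image of \<open>x\<close> under a composite of right translations
  (\<open>reaches_all_within_star\<close>, \<open>reaches_all_within_foldl\<close>). But by assumption these images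
  are all of the quandle, so any two elements are joined, in both directions, by paths of
  length at most \<open>n\<close>.
\<close>

context quandle
begin

definition reaches_all_within :: "nat \<Rightarrow> 'a \<Rightarrow> bool" where
  "reaches_all_within n u \<longleftrightarrow>
     (\<forall>a\<in>Q. \<exists>zs. set zs \<subseteq> Q \<and> length zs \<in> {1..n} \<and> a = foldl (\<star>) u zs)"

text \<open>Each step along the path uses self-distributivity once, to move the right translation
  by \<open>y\<close> past one factor.\<close>

lemma foldl_star_right_distrib:
  assumes "u \<in> Q" "y \<in> Q" "set zs \<subseteq> Q"
  shows "foldl (\<star>) u zs \<star> y = foldl (\<star>) (u \<star> y) (map (\<lambda>z. z \<star> y) zs)"
  using assms
proof (induction zs arbitrary: u)
  case Nil
  then show ?case by simp
next
  case (Cons z zs)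
  then show ?case using closed Q3[of u z y] by simp
qed

text \<open>To reach \<open>a\<close> from \<open>u \<star> y\<close>, pull \<open>a\<close> back along the right translation by \<open>y\<close>, reach
  the preimage from \<open>u\<close>, and push the path forward again.\<close>

lemma reaches_all_within_star:
  assumes "u \<in> Q" "y \<in> Q" and u: "reaches_all_within n u"
  shows "reaches_all_within n (u \<star> y)"
  unfolding reaches_all_within_def
proof
  fix a assume "a \<in> Q"
  then obtain w where w: "w \<in> Q" "a = w \<star> y"
    using Q2 \<open>y \<in> Q\<close> by blast
  then obtain zs where zs: "set zs \<subseteq> Q" "length zs \<in> {1..n}" "w = foldl (\<star>) u zs"
    using u unfolding reaches_all_within_def by blast
  let ?zs = "map (\<lambda>z. z \<star> y) zs"
  have "a = foldl (\<star>) (u \<star> y) ?zs"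
    using w zs foldl_star_right_distrib assms by simp
  moreover have "set ?zs \<subseteq> Q" "length ?zs \<in> {1..n}"
    using zs \<open>y \<in> Q\<close> closed by auto
  ultimately show "\<exists>zs. set zs \<subseteq> Q \<and> length zs \<in> {1..n} \<and> a = foldl (\<star>) (u \<star> y) zs"
    by blast
qed

lemma reaches_all_within_foldl:
  "\<lbrakk>u \<in> Q; set ys \<subseteq> Q; reaches_all_within n u\<rbrakk>
     \<Longrightarrow> reaches_all_within n (foldl (\<star>) u ys)"
  by (induction ys arbitrary: u) (auto simp: closed reaches_all_within_star)

lemma reaches_all_within_transfer:
  assumes "x \<in> Q" "reaches_all_within n x" "u \<in> Q"
  shows "reaches_all_within n u"
proof -
  obtain ys where "set ys \<subseteq> Q" "u = foldl (\<star>) x ys"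
    using assms unfolding reaches_all_within_def by blast
  then show ?thesis using assms reaches_all_within_foldl by simp
qed

lemma left_transl_surj_if_reaches_all_within_1:
  assumes "u \<in> Q" "reaches_all_within 1 u"
  shows "left_transl (\<star>) u ` Q = Q"
proof
  show "left_transl (\<star>) u ` Q \<subseteq> Q"
    using assms(1) closed by (auto simp: left_transl_def)
  show "Q \<subseteq> left_transl (\<star>) u ` Q"
  proof
    fix a assume "a \<in> Q"
    then obtain zs where zs: "set zs \<subseteq> Q" "length zs = 1" "a = foldl (\<star>) u zs"
      using assms(2) unfolding reaches_all_within_def by auto
    then obtain z where "zs = [z]"
      by (auto simp: length_Suc_conv)
    with zs show "a \<in> left_transl (\<star>) u ` Q"
      by (auto simp: left_transl_def)
  qed
qed

lemma connected_quandle_if_all_reach: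
  assumes "n \<ge> 1"
    and all: "\<And>u. u \<in> Q \<Longrightarrow> reaches_all_within n u"
    and "\<forall>m. 1 \<le> m \<and> m \<le> n - 1 \<longrightarrow> \<not> connected_quandle Q (\<star>) m"
  shows "connected_quandle Q (\<star>) n"
proof (cases "n = 1")
  case True
  then show ?thesis
    using all left_transl_surj_if_reaches_all_within_1
    by (simp add: connected_quandle.simps)
next
  case False
  have "\<exists>zs zs'. set zs \<subseteq> Q \<and> length zs \<in> {1..n} \<and> set zs' \<subseteq> Q \<and> length zs' \<in> {1..n} \<and>
          u = foldl (\<star>) v zs \<and> v = foldl (\<star>) u zs'" if "u \<in> Q" "v \<in> Q" for u v
    using all[OF that(1)] all[OF that(2)] that unfolding reaches_all_within_def by blast
  then show ?thesis
    using False assms by (subst connected_quandle.simps) simp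
qed

end

lemma fold_right_transl: "fold (right_transl star) zs x = foldl star x zs"
  by (induction zs arbitrary: x) (simp_all add: right_transl_def)

theorem theorem2p3:
  fixes Q :: "'a set" and star :: "'a \<Rightarrow> 'a \<Rightarrow> 'a" and n :: nat and x :: 'a
  assumes "n \<ge> 1"
    and "quandle Q star"
    and "x \<in> Q"
    and "\<forall>a\<in>Q. \<exists>xs. set xs \<subseteq> Q \<and> 1 \<le> length xs \<and> length xs \<le> n \<and>
           fold (right_transl star) xs x = a"
    and "\<forall>m. 1 \<le> m \<and> m \<le> n - 1 \<longrightarrow> \<not> connected_quandle Q star m"
  shows "connected_quandle Q star n"
proof -
  interpret quandle Q star by (rule assms(2))
  have "reaches_all_within n x"
    using assms(4) by (fastforce simp: reaches_all_within_def fold_right_transl)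
  then show ?thesis
    using connected_quandle_if_all_reach reaches_all_within_transfer assms(1,3,5) by blast
qed

end
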